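(* Let $\Omega=[0,1]$. For all non-zero $f\in A^2(\Omega)$ and all non-zero $g\in D(W_0^{1,2}(\Omega))$, the angle $\theta$ between $f$ and $g$ is $\theta=\frac{\pi}{2}$.
   Context: $\Omega=[0,1]$, $\partial\Omega=\{0,1\}$, and $D=\frac{d}{dx}$ (weak derivative). $L^2(\Omega)$ is the real Hilbert space of (classes of) measurable functions $f:\Omega\to\mathbb{R}$ with $\int_\Omega f^2\,dx<\infty$, with inner product $\langle f,g\rangle=\int_\Omega f(x)g(x)\,dx$ and norm $\|f\|=\sqrt{\langle f,f\rangle}$. $W^{1,2}(\Omega)=\{f\in L^2(\Omega): Df\in L^2(\Omega)\}$, and $W_0^{1,2}(\Omega)=\{f\in W^{1,2}(\Omega): f|_{\partial\Omega}=0\}$ (restriction in the sense of trace). $D(W_0^{1,2}(\Omega))=\{Dh: h\in W_0^{1,2}(\Omega)\}$. $A^2(\Omega)=\{g\in L^2(\Omega): Dg=0 \text{ on } \Omega\}$, i.e. the space of constant functions. The angle between non-zero $f,g\in L^2(\Omega)$ is defined as $\theta=\cos^{-1}\left(\frac{\langle f,g\rangle}{\|f\|\,\|g\|}\right)\in[0,\pi]$. *)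

theory Defs
  imports "HOL-Analysis.Analysis"
begin

text \<open>
  Elements of the function spaces below are represented by functions
  \<^typ>\<open>real \<Rightarrow> real\<close>; two representatives denote the same class iff they agree almost
  everywhere on \<open>\<Omega>\<close>. All spaces are saturated under this equivalence, and values outside
  \<open>\<Omega>\<close> are irrelevant.
\<close>

abbreviation Omega :: "real set" ("\<Omega>")
  where "\<Omega> \<equiv> {0..1}"

abbreviation boundary :: "real set" ("\<partial>\<Omega>")
  where "\<partial>\<Omega> \<equiv> {0, 1}"

definition L2 :: "(real \<Rightarrow> real) set" where
  "L2 = {f \<in> borel_measurable (lebesgue_on \<Omega>). integrable (lebesgue_on \<Omega>) (\<lambda>x. (f x)\<^sup>2)}"

definition L2_inner :: "(real \<Rightarrow> real) \<Rightarrow> (real \<Rightarrow> real) \<Rightarrow> real" where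
  "L2_inner f g = (LINT x|lebesgue_on \<Omega>. f x * g x)"

definition L2_norm :: "(real \<Rightarrow> real) \<Rightarrow> real" where
  "L2_norm f = sqrt (L2_inner f f)"

definition L2_zero :: "(real \<Rightarrow> real) \<Rightarrow> bool" where
  "L2_zero f \<longleftrightarrow> (AE x in lebesgue_on \<Omega>. f x = 0)"

definition L2_angle :: "(real \<Rightarrow> real) \<Rightarrow> (real \<Rightarrow> real) \<Rightarrow> real" where
  "L2_angle f g = arccos (L2_inner f g / (L2_norm f * L2_norm g))"

definition test_functions :: "(real \<Rightarrow> real) set" where
  "test_functions =
     {\<phi>. (\<forall>n x. ((deriv ^^ n) \<phi>) field_differentiable (at x)) \<and>
         compact (closure {x. \<phi> x \<noteq> 0}) \<and> closure {x. \<phi> x \<noteq> 0} \<subseteq> interior \<Omega>}"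

text \<open>Only meaningful for \<open>f, g \<in> L2\<close>, where all the integrals exist; every use below
  carries these guards.\<close>

definition has_weak_deriv :: "(real \<Rightarrow> real) \<Rightarrow> (real \<Rightarrow> real) \<Rightarrow> bool" where
  "has_weak_deriv f g \<longleftrightarrow>
     (\<forall>\<phi>\<in>test_functions.
        (LINT x|lebesgue_on \<Omega>. f x * deriv \<phi> x) = - (LINT x|lebesgue_on \<Omega>. g x * \<phi> x))"

definition W12 :: "(real \<Rightarrow> real) set" where
  "W12 = {f \<in> L2. \<exists>g\<in>L2. has_weak_deriv f g}"

text \<open>The trace operator is the bounded linear map from \<open>W12\<close> to functions on the two-point
  set \<open>\<partial>\<Omega>\<close> that restricts continuous representatives to \<open>\<partial>\<Omega>\<close>. It is uniquely determined
  on \<open>W12\<close>, and boundedness together with linearity makes it independent of representatives.\<close>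

definition trace_operator :: "((real \<Rightarrow> real) \<Rightarrow> real \<Rightarrow> real) \<Rightarrow> bool" where
  "trace_operator T \<longleftrightarrow>
     (\<forall>u\<in>W12. \<forall>v\<in>W12. \<forall>x\<in>\<partial>\<Omega>. T (\<lambda>y. u y + v y) x = T u x + T v x) \<and>
     (\<forall>u\<in>W12. \<forall>c. \<forall>x\<in>\<partial>\<Omega>. T (\<lambda>y. c * u y) x = c * T u x) \<and>
     (\<exists>C. \<forall>u\<in>L2. \<forall>u'\<in>L2. has_weak_deriv u u' \<longrightarrow>
        sqrt (\<Sum>x\<in>\<partial>\<Omega>. (T u x)\<^sup>2) \<le> C * sqrt ((L2_norm u)\<^sup>2 + (L2_norm u')\<^sup>2)) \<and>
     (\<forall>u\<in>W12. continuous_on \<Omega> u \<longrightarrow> (\<forall>x\<in>\<partial>\<Omega>. T u x = u x))"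

definition W12_0 :: "(real \<Rightarrow> real) set" where
  "W12_0 = {f \<in> W12. \<exists>T. trace_operator T \<and> (\<forall>x\<in>\<partial>\<Omega>. T f x = 0)}"

definition D_image :: "(real \<Rightarrow> real) set \<Rightarrow> (real \<Rightarrow> real) set" where
  "D_image H = {g \<in> L2. \<exists>h\<in>H. has_weak_deriv h g}"

definition A2 :: "(real \<Rightarrow> real) set" where
  "A2 = {g \<in> L2. has_weak_deriv g (\<lambda>x. 0)}"

end

(*
  The space A^2 consists of the functions that are a.e. constant (du Bois-Reymond), so it suffices
  that a weak derivative g of some h in W_0^{1,2} has integral 0. With G(x) the integral of g over
  [0,x], h - G has weak derivative 0 and is therefore a.e. equal to a constant c. The continuous
  function G + c represents the class of h and so has the same trace, namely 0; hence
  G(1) = G(0) = 0.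
*)
theory Submission
  imports Defs
begin

text \<open>A weak derivative is tested only against derivatives of test functions, which are the
  smooth functions of mean zero with compact support inside the interval; that is why vanishing
  against all of them yields a constant rather than 0. To exploit this, enough test functions with
  prescribed derivative must be exhibited, hence the explicit family built from exp(-1/x). Two
  further obstacles shape the proof. G is a primitive of a merely integrable function, so it need
  not be differentiable at every point and the product rule cannot be applied to it directly. A
  trace operator is known only through its properties, so the trace of h becomes accessible only
  after h is replaced by a continuous function, and the norm bound of the operator is what justifies
  the replacement.\<close>

section \<open>Flat functions and the algebra they generate\<close>

text \<open>The classical flat function exp(-1/x), extended by 0, and its quotients by powers of x.
  The index is there because differentiating \<open>flat k\<close> produces a combination of
  \<open>flat (k + 1)\<close> and \<open>flat (k + 2)\<close>, so the span of the family is closed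
  under differentiation.\<close>

definition flat :: "nat \<Rightarrow> real \<Rightarrow> real" where
  "flat k x = (if x > 0 then exp (- (1 / x)) / x ^ k else 0)"

lemma flat_tendsto_0_right: "(flat k \<longlongrightarrow> 0) (at_right 0)"
proof -
  have "((\<lambda>x. inverse x ^ k / exp (inverse x)) \<longlongrightarrow> (0::real)) (at_right 0)"
    by (rule filterlim_compose[OF tendsto_power_div_exp_0 filterlim_inverse_at_top_right])
  moreover have "\<forall>\<^sub>F x in at_right 0. inverse x ^ k / exp (inverse x) = flat k x"
    unfolding eventually_at_right_field
    by (auto simp: flat_def exp_minus divide_inverse power_inverse intro!: exI[of _ 1])
  ultimately show ?thesis
    by (rule Lim_transform_eventually)
qed

lemma flat_has_derivative:
  "(flat k has_real_derivative flat (k + 2) x - of_nat k * flat (k + 1) x) (at x)"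
proof -
  consider "x > 0" | "x < 0" | "x = 0" by linarith
  then show ?thesis
  proof cases
    case 1
    have "((\<lambda>x. exp (- (1 / x)) / x ^ k) has_real_derivative
            flat (k + 2) x - of_nat k * flat (k + 1) x) (at x)"
    proof -
      have *: "x * x ^ (m - Suc 0) = x ^ m" if "m \<noteq> 0" for m
        using that by (cases m) auto
      then show ?thesis
        using 1 by (cases k) (auto intro!: derivative_eq_intros simp: flat_def field_simps, metis * neq0_conv)
    qed
    then show ?thesis
      by (rule has_field_derivative_transform_within_open[where S = "{0<..}"])
         (use 1 in \<open>auto simp: flat_def\<close>)
  next
    case 2
    have "((\<lambda>x. 0) has_real_derivative flat (k + 2) x - of_nat k * flat (k + 1) x) (at x)"
      using 2 by (simp add: flat_def)
    then show ?thesis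
      by (rule has_field_derivative_transform_within_open[where S = "{..<0}"])
         (use 2 in \<open>auto simp: flat_def\<close>)
  next
    case 3
    have "((\<lambda>y. (flat k y - flat k 0) / (y - 0)) \<longlongrightarrow> 0) (at 0)"
    proof (rule filterlim_split_at)
      show "((\<lambda>y. (flat k y - flat k 0) / (y - 0)) \<longlongrightarrow> 0) (at_left 0)"
        by (rule tendsto_eventually)
           (auto simp: flat_def eventually_at_left_field intro!: exI[of _ "-1"])
      \<comment> \<open>To the right of 0 the difference quotient of \<open>flat k\<close> at 0 is
        the next member of the family, whose limit is already known.\<close>
      have "\<forall>\<^sub>F y in at_right 0. flat (Suc k) y = (flat k y - flat k 0) / (y - 0)"
        unfolding eventually_at_right_field by (auto simp: flat_def intro!: exI[of _ 1])
      then show "((\<lambda>y. (flat k y - flat k 0) / (y - 0)) \<longlongrightarrow> 0) (at_right 0)"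
        by (rule Lim_transform_eventually[OF flat_tendsto_0_right])
    qed
    then show ?thesis
      using 3 by (simp add: has_field_derivative_iff flat_def)
  qed
qed

lemma flat_0_bounds: "0 \<le> flat 0 x" "flat 0 x \<le> 1"
  by (auto simp: flat_def)

text \<open>With its limit 1 at infinity and the value 0 on the negative axis, \<open>flat 0\<close>
  becomes a smooth approximate step function once its argument is scaled steeply.\<close>

lemma flat_0_tendsto_1: "(flat 0 \<longlongrightarrow> 1) at_top"
proof -
  have "((\<lambda>x. exp (- inverse x)) \<longlongrightarrow> exp (- 0 :: real)) at_top"
    by (intro tendsto_intros tendsto_inverse_0_at_top filterlim_ident)
  moreover have "\<forall>\<^sub>F x in at_top. exp (- inverse x) = flat 0 x"
    using eventually_gt_at_top[of 0] by eventually_elim (simp add: flat_def divide_inverse)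
  ultimately show ?thesis
    using Lim_transform_eventually by fastforce
qed

text \<open>
  This algebra is closed under differentiation, so its members are smooth without any need for
  Leibniz or chain rules for higher derivatives. It contains enough bump functions to approximate
  the indicator functions of intervals.
\<close>

inductive_set flat_alg :: "(real \<Rightarrow> real) set" where
  const: "(\<lambda>_. c) \<in> flat_alg"
| flat: "(\<lambda>x. flat k (m * x + b)) \<in> flat_alg"
| add: "u \<in> flat_alg \<Longrightarrow> v \<in> flat_alg \<Longrightarrow> (\<lambda>x. u x + v x) \<in> flat_alg"
| mult: "u \<in> flat_alg \<Longrightarrow> v \<in> flat_alg \<Longrightarrow> (\<lambda>x. u x * v x) \<in> flat_alg"

lemma flat_alg_has_derivative:
  "u \<in> flat_alg \<Longrightarrow> \<exists>u'\<in>flat_alg. \<forall>x. (u has_real_derivative u' x) (at x)"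
proof (induction rule: flat_alg.induct)
  case (const c)
  show ?case
    by (rule bexI[OF _ flat_alg.const[of 0]]) simp
next
  case (flat k m b)
  have "(\<lambda>x. (flat (k+2) (m*x+b) + (- of_nat k) * flat (k+1) (m*x+b)) * m) \<in> flat_alg"
    by (intro flat_alg.intros)
  moreover have "((\<lambda>x. flat k (m * x + b)) has_real_derivative
      (flat (k+2) (m*x+b) + (- of_nat k) * flat (k+1) (m*x+b)) * m) (at x)" for x
    by (rule DERIV_chain2[OF flat_has_derivative, THEN DERIV_cong])
       (auto intro!: derivative_eq_intros)
  ultimately show ?case by (intro bexI allI)
next
  case (add u v)
  then obtain u' v' where "u' \<in> flat_alg" "v' \<in> flat_alg"
    "\<And>x. (u has_real_derivative u' x) (at x)" "\<And>x. (v has_real_derivative v' x) (at x)"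
    by blast
  then show ?case
    by (intro bexI[of _ "\<lambda>x. u' x + v' x"] allI DERIV_add flat_alg.add)
next
  case (mult u v)
  then obtain u' v' where "u' \<in> flat_alg" "v' \<in> flat_alg"
    "\<And>x. (u has_real_derivative u' x) (at x)" "\<And>x. (v has_real_derivative v' x) (at x)"
    by blast
  with mult.hyps show ?case
    by (intro bexI[of _ "\<lambda>x. u' x * v x + v' x * u x"] allI DERIV_mult flat_alg.intros)
qed

lemma higher_deriv_flat_alg:
  assumes "u \<in> flat_alg"
  shows "(deriv ^^ n) u \<in> flat_alg"
proof (induction n)
  case 0
  show ?case using assms by simp
next
  case (Suc n)
  obtain v where v: "v \<in> flat_alg" "\<And>x. ((deriv ^^ n) u has_real_derivative v x) (at x)"
    using flat_alg_has_derivative[OF Suc] by blast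
  have "deriv ((deriv ^^ n) u) = v"
    using v(2) by (auto intro: DERIV_imp_deriv)
  with v(1) show ?case by simp
qed

lemma flat_alg_differentiable: "u \<in> flat_alg \<Longrightarrow> u field_differentiable (at x)"
  using flat_alg_has_derivative field_differentiable_def by blast

lemma flat_alg_continuous_on: "u \<in> flat_alg \<Longrightarrow> continuous_on S u"
  by (intro continuous_at_imp_continuous_on ballI field_differentiable_imp_continuous_at
      flat_alg_differentiable)

section \<open>Test functions with prescribed derivative\<close>

text \<open>The primitive from 0 vanishes left of \<open>d\<close> because \<psi> does, and right of
  \<open>1 - d\<close> because the total integral is 0: mean zero turns into compact support.
  Smoothness follows since every derivative of the primitive is an iterated derivative of \<psi> and
  so lies in \<open>flat_alg\<close>.\<close>

lemma test_function_with_deriv: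
  assumes "\<psi> \<in> flat_alg" and "d > 0"
    and supp: "\<And>x. x \<notin> {d..1-d} \<Longrightarrow> \<psi> x = 0"
    and int: "integral \<Omega> \<psi> = 0"
  obtains \<phi> where "\<phi> \<in> test_functions" "deriv \<phi> = \<psi>"
proof -
  define \<phi> where "\<phi> x = integral {0..x} \<psi>" for x
  have cont: "continuous_on S \<psi>" for S
    by (rule flat_alg_continuous_on) fact
  have left: "\<phi> x = 0" if "x < d" for x
    unfolding \<phi>_def by (rule integral_unique, rule has_integral_is_0) (use supp that in auto)
  have right: "\<phi> x = 0" if "1 - d < x" for x
  proof (cases "x < d")
    case False
    then have "x > 0" using \<open>d > 0\<close> by linarith
    \<comment> \<open>A common right endpoint: the integrals up to x and up to 1 both equal the one
      up to \<open>m\<close>, without distinguishing x <= 1 from x > 1.\<close>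
    define m where "m = max x 1"
    have zero: "integral {y..m} \<psi> = 0" if "1 - d < y" for y
      by (rule integral_unique, rule has_integral_is_0) (use supp that in auto)
    have split: "integral {0..y} \<psi> + integral {y..m} \<psi> = integral {0..m} \<psi>"
      if "0 \<le> y" "y \<le> m" for y
      by (rule Henstock_Kurzweil_Integration.integral_combine)
         (use that in \<open>auto intro: integrable_continuous_real cont\<close>)
    have "integral {0..x} \<psi> = integral {0..1} \<psi>"
      using split[of x] split[of 1] zero[of x] zero[of 1] \<open>x > 0\<close> \<open>d > 0\<close> that
      by (simp add: m_def)
    then show ?thesis using int by (simp add: \<phi>_def)
  qed (simp add: left)
  \<comment> \<open>At 0 the fundamental theorem for integrals over \<open>{0..x}\<close> is only
    one-sided, so for x < d the derivative comes from the local vanishing of \<phi> instead.\<close>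
  have deriv: "(\<phi> has_real_derivative \<psi> x) (at x)" for x
  proof (cases "x < d")
    case True
    have "((\<lambda>x. 0) has_real_derivative \<psi> x) (at x)"
      using True supp[of x] by simp
    then show ?thesis
      by (rule has_field_derivative_transform_within_open[where S = "{..<d}"])
         (use True left in auto)
  next
    case False
    then have "x > 0" using \<open>d > 0\<close> by linarith
    then have "at x within {0..x+1} = at x"
      by (intro at_within_interior) simp
    moreover have "\<phi> = (\<lambda>x. integral {0..x} \<psi>)"
      by (auto simp: \<phi>_def)
    ultimately show ?thesis
      using integral_has_real_derivative[OF cont, of x 0 "x+1"] \<open>x > 0\<close> by simp
  qed
  then have deriv_eq: "deriv \<phi> = \<psi>"
    by (auto intro: DERIV_imp_deriv)
  have "(deriv ^^ n) \<phi> field_differentiable (at x)" for n x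
  proof (cases n)
    case 0
    then show ?thesis using deriv field_differentiable_def by auto
  next
    case (Suc m)
    then have "(deriv ^^ n) \<phi> = (deriv ^^ m) \<psi>"
      by (simp add: funpow_Suc_right deriv_eq del: funpow.simps)
    then show ?thesis
      using flat_alg_differentiable[OF higher_deriv_flat_alg[OF \<open>\<psi> \<in> flat_alg\<close>]] by simp
  qed
  moreover have sub: "closure {x. \<phi> x \<noteq> 0} \<subseteq> {d..1-d}"
  proof (rule closure_minimal)
    show "{x. \<phi> x \<noteq> 0} \<subseteq> {d..1-d}"
      using left right by (auto simp: not_less[symmetric])
  qed simp
  moreover have "compact (closure {x. \<phi> x \<noteq> 0})"
    using sub by (meson bounded_closed_interval bounded_subset closed_closure compact_eq_bounded_closed)
  ultimately have "\<phi> \<in> test_functions"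
    using \<open>d > 0\<close> by (auto simp: test_functions_def)
  with deriv_eq that show thesis by blast
qed

lemma test_function_has_deriv:
  assumes "\<phi> \<in> test_functions"
  shows "(\<phi> has_real_derivative deriv \<phi> x) (at x)"
    and "continuous_on S \<phi>" and "continuous_on S (deriv \<phi>)"
proof -
  have "((deriv ^^ 0) \<phi>) field_differentiable (at x)" "((deriv ^^ 1) \<phi>) field_differentiable (at x)" for x
    using assms unfolding test_functions_def by blast+
  then have *: "\<phi> field_differentiable (at x)" "deriv \<phi> field_differentiable (at x)" for x
    by simp_all
  show "(\<phi> has_real_derivative deriv \<phi> x) (at x)"
    using * by (simp add: DERIV_deriv_iff_field_differentiable)
  show "continuous_on S \<phi>" "continuous_on S (deriv \<phi>)"
    using * by (auto intro!: continuous_at_imp_continuous_on field_differentiable_imp_continuous_at)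
qed

lemma test_function_boundary:
  assumes "\<phi> \<in> test_functions"
  shows "\<phi> 0 = 0" "\<phi> 1 = 0"
proof -
  have "{x. \<phi> x \<noteq> 0} \<subseteq> {0<..<1}"
    using assms closure_subset[of "{x. \<phi> x \<noteq> 0}"] by (auto simp: test_functions_def)
  then show "\<phi> 0 = 0" "\<phi> 1 = 0" by auto
qed

section \<open>From weak derivatives to the du Bois-Reymond lemma\<close>

lemma absolutely_integrable_mult_continuous:
  fixes u v :: "real \<Rightarrow> real"
  assumes "u absolutely_integrable_on {a..b}" and "continuous_on {a..b} v"
  shows "(\<lambda>x. u x * v x) absolutely_integrable_on {a..b}"
proof -
  have "(\<lambda>x. v x * u x) absolutely_integrable_on {a..b}"
  proof (rule absolutely_integrable_bounded_measurable_product_real)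
    show "v \<in> borel_measurable (lebesgue_on {a..b})"
      by (rule continuous_imp_measurable_on_sets_lebesgue) (use assms in auto)
    show "bounded (v ` {a..b})"
      by (intro compact_imp_bounded compact_continuous_image assms) auto
  qed (use assms in auto)
  then show ?thesis by (simp add: mult.commute)
qed

text \<open>Passes from the Lebesgue integrals of the definition to gauge integrals, in which the
  calculus below is done. The two agree because the product of an absolutely integrable and a
  continuous function is absolutely integrable.\<close>

lemma weak_deriv_integral:
  assumes "u absolutely_integrable_on \<Omega>" "v absolutely_integrable_on \<Omega>"
  shows "has_weak_deriv u v \<longleftrightarrow> (\<forall>\<phi>\<in>test_functions.
           integral \<Omega> (\<lambda>x. u x * deriv \<phi> x) = - integral \<Omega> (\<lambda>x. v x * \<phi> x))"
proof -
  have "(LINT x|lebesgue_on \<Omega>. w x * \<phi> x) = integral \<Omega> (\<lambda>x. w x * \<phi> x)"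
    if "w absolutely_integrable_on \<Omega>" "continuous_on \<Omega> \<phi>" for w \<phi> :: "real \<Rightarrow> real"
    using absolutely_integrable_mult_continuous[OF that]
    by (simp add: lebesgue_integral_eq_integral absolutely_integrable_imp_integrable)
  then show ?thesis
    unfolding has_weak_deriv_def using assms test_function_has_deriv(2,3) by simp
qed

text \<open>By Lebesgue differentiation; the library provides it for the right-sided averages of \<open>w\<close>.\<close>

lemma interval_integrals_zero_imp_AE_zero:
  fixes v :: "real \<Rightarrow> real"
  assumes v: "v integrable_on {a..b}"
    and zero: "\<And>c d. a \<le> c \<Longrightarrow> c < d \<Longrightarrow> d \<le> b \<Longrightarrow> integral {c..d} v = 0"
  shows "AE x in lebesgue_on {a..b}. v x = 0"
proof -
  \<comment> \<open>Extension by 0 gives integrability on every \<open>cbox\<close>, as the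
    differentiation theorem demands.\<close>
  define w where "w x = (if x \<in> {a..b} then v x else 0)" for x
  have "w integrable_on UNIV"
    using v unfolding w_def by (subst integrable_restrict_UNIV)
  then have "w integrable_on cbox c d" for c d
    by (rule integrable_on_subcbox) simp
  then obtain N where "negligible N" and N: "\<And>x e. \<lbrakk>x \<notin> N; 0 < e\<rbrakk> \<Longrightarrow> \<exists>d>0. \<forall>h. 0 < h \<and> h < d \<longrightarrow>
      norm (integral (cbox x (x + h *\<^sub>R One)) w /\<^sub>R h ^ DIM(real) - w x) < e"
    using integrable_ccontinuous_explicit[of w] by blast
  \<comment> \<open>The endpoint b is left out because right-sided averages there leave the
    interval; it joins the null set afterwards.\<close>
  have "v x = 0" if x: "x \<in> {a..<b}" "x \<notin> N" for x
  proof (rule ccontr)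
    assume "v x \<noteq> 0"
    then obtain d where "d > 0" and d: "\<And>h. 0 < h \<Longrightarrow> h < d \<Longrightarrow>
        norm (integral {x..x+h} w / h - w x) < \<bar>v x\<bar>"
      using N[OF x(2), of "\<bar>v x\<bar>"] by (auto simp: divide_inverse_commute)
    define h where "h = min (d / 2) (b - x)"
    have h: "0 < h" "h < d" "x + h \<le> b"
      using x \<open>d > 0\<close> by (auto simp: h_def)
    have "integral {x..x+h} w = integral {x..x+h} v"
      by (rule integral_cong) (use h x in \<open>auto simp: w_def\<close>)
    also have "\<dots> = 0"
      by (rule zero) (use h x in auto)
    finally show False
      using d[OF h(1,2)] x by (simp add: w_def)
  qed
  moreover have "negligible (insert b N)"
    using \<open>negligible N\<close> by simp
  ultimately have "AE x in lebesgue. x \<in> {a..b} \<longrightarrow> v x = 0"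
    unfolding eventually_ae_filter_negligible by (intro exI[of _ "insert b N"]) force
  then show ?thesis
    by (simp add: AE_restrict_space_iff)
qed

text \<open>Two steep copies of \<open>flat 0\<close> facing each other are multiplied: inside the
  interval both arguments tend to infinity, outside it one factor is always 0.\<close>

lemma interval_indicator_approx:
  fixes a b :: real
  assumes "0 \<le> a" "b \<le> 1"
  obtains \<psi> :: "nat \<Rightarrow> real \<Rightarrow> real"
  where "\<And>n. \<psi> n \<in> flat_alg" "\<And>n x. \<bar>\<psi> n x\<bar> \<le> 1"
    "\<And>n. \<exists>d>0. \<forall>x. x \<notin> {d..1-d} \<longrightarrow> \<psi> n x = 0"
    "\<And>x. (\<lambda>n. \<psi> n x) \<longlonglongrightarrow> (if x \<in> {a<..<b} then 1 else 0)"
proof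
  \<comment> \<open>The \<open>- 1\<close> in each argument confines the nonzero values to points
    between a + 1/(n+1) and b - 1/(n+1), hence at distance 1/(n+1) from the boundary of the unit
    interval.\<close>
  define \<psi> where "\<psi> n x = flat 0 (real (Suc n) * x + (- real (Suc n) * a - 1)) *
    flat 0 (- real (Suc n) * x + (real (Suc n) * b - 1))" for n x
  show "\<psi> n \<in> flat_alg" for n
    unfolding \<psi>_def by (intro flat_alg.intros)
  show "\<bar>\<psi> n x\<bar> \<le> 1" for n x
    unfolding \<psi>_def abs_mult by (intro mult_le_one) (auto simp: flat_0_bounds)
  have supp: "a + 1 / real (Suc n) < x \<and> x < b - 1 / real (Suc n)" if "\<psi> n x \<noteq> 0" for n x
  proof -
    have "real (Suc n) * x + (- real (Suc n) * a - 1) > 0"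
         "- real (Suc n) * x + (real (Suc n) * b - 1) > 0"
      using that by (auto simp: \<psi>_def flat_def split: if_splits)
    then show ?thesis by (simp add: field_simps)
  qed
  show "\<exists>d>0. \<forall>x. x \<notin> {d..1-d} \<longrightarrow> \<psi> n x = 0" for n
    by (rule exI[of _ "1 / real (Suc n)"]) (use supp[of n] assms in fastforce)
  show "(\<lambda>n. \<psi> n x) \<longlonglongrightarrow> (if x \<in> {a<..<b} then 1 else 0)" for x
  proof (cases "x \<in> {a<..<b}")
    case True
    have lim: "(\<lambda>n. flat 0 (real (Suc n) * c + (-1))) \<longlonglongrightarrow> 1" if "c > 0" for c
    proof (rule filterlim_compose[OF flat_0_tendsto_1])
      have "filterlim (\<lambda>n. real (Suc n)) at_top sequentially"
        by (rule filterlim_compose[OF filterlim_real_sequentially filterlim_Suc])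
      then have "filterlim (\<lambda>n. c * real (Suc n)) at_top sequentially"
        using that by (intro filterlim_tendsto_pos_mult_at_top[OF tendsto_const])
      then have "filterlim (\<lambda>n. (-1) + c * real (Suc n)) at_top sequentially"
        by (intro filterlim_tendsto_add_at_top[OF tendsto_const])
      then show "filterlim (\<lambda>n. real (Suc n) * c + (-1)) at_top sequentially"
        by (simp add: algebra_simps)
    qed
    have "(\<lambda>n. flat 0 (real (Suc n) * (x - a) + (-1)) * flat 0 (real (Suc n) * (b - x) + (-1))) \<longlonglongrightarrow> 1 * 1"
      using True by (intro tendsto_mult lim) auto
    moreover have "\<psi> n x = flat 0 (real (Suc n) * (x - a) + (-1)) * flat 0 (real (Suc n) * (b - x) + (-1))" for n
      by (simp add: \<psi>_def algebra_simps)
    ultimately show ?thesis using True by simp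
  next
    case False
    have "\<psi> n x = 0" for n
    proof (rule ccontr)
      assume "\<psi> n x \<noteq> 0"
      moreover have "1 / real (Suc n) > 0" by simp
      ultimately have "a < x \<and> x < b" using supp[of n x] by linarith
      with False show False by simp
    qed
    then show ?thesis using False by auto
  qed
qed

text \<open>Dominated convergence with bound \<bar>u\<bar>; the open interval in the limit differs
  from the closed one by a null set.\<close>

lemma tendsto_integral_mult_indicator:
  fixes u :: "real \<Rightarrow> real"
  assumes u: "u absolutely_integrable_on \<Omega>" and ab: "0 \<le> a" "b \<le> 1"
    and \<psi>: "\<And>n. \<psi> n \<in> flat_alg" "\<And>n x. \<bar>\<psi> n x\<bar> \<le> 1"
      "\<And>x. (\<lambda>n. \<psi> n x) \<longlonglongrightarrow> (if x \<in> {a<..<b} then 1 else 0)"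
  shows "(\<lambda>n. integral \<Omega> (\<lambda>x. u x * \<psi> n x)) \<longlonglongrightarrow> integral {a..b} u"
proof -
  have "(\<lambda>n. integral \<Omega> (\<lambda>x. u x * \<psi> n x)) \<longlonglongrightarrow>
        integral \<Omega> (\<lambda>x. if x \<in> {a<..<b} then u x else 0)"
  proof (rule dominated_convergence(2)[where h = "\<lambda>x. \<bar>u x\<bar>"])
    show "(\<lambda>x. u x * \<psi> n x) integrable_on \<Omega>" for n
      using absolutely_integrable_mult_continuous[OF u flat_alg_continuous_on[OF \<psi>(1)]]
      by (simp add: absolutely_integrable_on_def)
    show "(\<lambda>x. \<bar>u x\<bar>) integrable_on \<Omega>"
      using u by (simp add: absolutely_integrable_on_def)
    show "norm (u x * \<psi> n x) \<le> \<bar>u x\<bar>" for n x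
      using mult_left_mono[OF \<psi>(2)[of n x], of "\<bar>u x\<bar>"] by (simp add: abs_mult)
    show "(\<lambda>n. u x * \<psi> n x) \<longlonglongrightarrow> (if x \<in> {a<..<b} then u x else 0)" for x
      using tendsto_mult[OF tendsto_const[of "u x"] \<psi>(3)[of x]] by (cases "x \<in> {a<..<b}") auto
  qed
  also have "integral \<Omega> (\<lambda>x. if x \<in> {a<..<b} then u x else 0) = integral {a<..<b} u"
  proof -
    have "{a<..<b} \<inter> \<Omega> = {a<..<b}" using ab by auto
    then show ?thesis
      by (simp only: Henstock_Kurzweil_Integration.integral_restrict_Int)
  qed
  finally show ?thesis
    by (simp add: integral_open_interval_real)
qed

text \<open>A compactly supported member of \<open>flat_alg\<close> is the derivative of a test
  function only if its mean is 0. Subtracting a multiple of one fixed bump \<eta> repairs the mean,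
  and the constant c absorbs the cost: u - c is orthogonal to all such functions, so in the limit
  its integrals over intervals vanish.\<close>

lemma du_Bois_Reymond:
  assumes u: "u absolutely_integrable_on \<Omega>"
    and zero: "\<And>\<phi>. \<phi> \<in> test_functions \<Longrightarrow> integral \<Omega> (\<lambda>x. u x * deriv \<phi> x) = 0"
  obtains c where "AE x in lebesgue_on \<Omega>. u x = c"
proof -
  have intg: "(\<lambda>x. w x * \<psi> x) integrable_on \<Omega>"
    if "w absolutely_integrable_on \<Omega>" "\<psi> \<in> flat_alg" for w \<psi>
    using absolutely_integrable_mult_continuous[OF that(1) flat_alg_continuous_on[OF that(2)]]
    by (simp add: absolutely_integrable_on_def)
  have one: "(\<lambda>x. 1 :: real) absolutely_integrable_on \<Omega>"
    by (rule absolutely_integrable_continuous_real) simp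
  obtain \<eta> d\<^sub>0 where \<eta>: "\<eta> \<in> flat_alg" "integral \<Omega> \<eta> \<noteq> 0" "d\<^sub>0 > 0" "\<And>x. x \<notin> {d\<^sub>0..1-d\<^sub>0} \<Longrightarrow> \<eta> x = 0"
  proof -
    obtain \<psi> :: "nat \<Rightarrow> real \<Rightarrow> real" where \<psi>: "\<And>n. \<psi> n \<in> flat_alg" "\<And>n x. \<bar>\<psi> n x\<bar> \<le> 1"
      "\<And>n. \<exists>d>0. \<forall>x. x \<notin> {d..1-d} \<longrightarrow> \<psi> n x = 0"
      "\<And>x. (\<lambda>n. \<psi> n x) \<longlonglongrightarrow> (if x \<in> {0<..<1} then 1 else 0)"
      using interval_indicator_approx[of 0 1] by (metis order_refl)
    \<comment> \<open>No bump has to be integrated explicitly: the integrals of the approximants to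
      the indicator of (0,1) tend to 1, so one of them is nonzero.\<close>
    have "(\<lambda>n. integral \<Omega> (\<psi> n)) \<longlonglongrightarrow> 1"
      using tendsto_integral_mult_indicator[OF one _ _ \<psi>(1,2,4)] by simp
    then have "\<forall>\<^sub>F n in sequentially. integral \<Omega> (\<psi> n) \<noteq> 0"
      by (rule tendsto_imp_eventually_ne) simp
    then obtain n where "integral \<Omega> (\<psi> n) \<noteq> 0"
      by (auto simp: eventually_sequentially)
    with \<psi>(1,3) that show thesis by metis
  qed
  \<comment> \<open>The value that makes \<open>u - c\<close> orthogonal to \<eta>.\<close>
  define c where "c = integral \<Omega> (\<lambda>x. u x * \<eta> x) / integral \<Omega> \<eta>"
  define v where "v x = u x - c" for x
  have v: "v absolutely_integrable_on \<Omega>"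
    unfolding v_def by (intro set_integral_diff u absolutely_integrable_continuous_real) simp
  have v_orth: "integral \<Omega> (\<lambda>x. v x * \<psi> x) = 0"
    if \<psi>: "\<psi> \<in> flat_alg" "d > 0" "\<And>x. x \<notin> {d..1-d} \<Longrightarrow> \<psi> x = 0" for \<psi> d
  proof -
    define r where "r = integral \<Omega> \<psi> / integral \<Omega> \<eta>"
    define \<psi>' where "\<psi>' x = \<psi> x + (- r) * \<eta> x" for x
    have "\<psi>' \<in> flat_alg"
      unfolding \<psi>'_def by (intro flat_alg.intros \<psi> \<eta>)
    moreover have "min d d\<^sub>0 > 0"
      using \<psi>(2) \<eta>(3) by simp
    moreover have "\<psi>' x = 0" if "x \<notin> {min d d\<^sub>0..1 - min d d\<^sub>0}" for x
    proof -
      have "\<psi> x = 0" "\<eta> x = 0"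
        using that by (auto intro!: \<psi>(3) \<eta>(4))
      then show ?thesis by (simp add: \<psi>'_def)
    qed
    \<comment> \<open>Taken with w = 1 this shows that \<psi>' has mean zero; taken with w = u it
      carries the orthogonality of u to \<psi>' back to \<psi>.\<close>
    moreover have lin: "integral \<Omega> (\<lambda>x. w x * \<psi>' x) =
        integral \<Omega> (\<lambda>x. w x * \<psi> x) - r * integral \<Omega> (\<lambda>x. w x * \<eta> x)"
      if "w absolutely_integrable_on \<Omega>" for w
    proof -
      have "integral \<Omega> (\<lambda>x. w x * \<psi>' x) = integral \<Omega> (\<lambda>x. w x * \<psi> x - r * (w x * \<eta> x))"
        by (simp add: \<psi>'_def algebra_simps)
      also have "\<dots> = integral \<Omega> (\<lambda>x. w x * \<psi> x) - integral \<Omega> (\<lambda>x. r * (w x * \<eta> x))"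
        by (intro Henstock_Kurzweil_Integration.integral_diff integrable_on_mult_right intg that \<psi> \<eta>)
      finally show ?thesis by simp
    qed
    have "integral \<Omega> \<psi>' = 0"
      using lin[OF one] \<eta>(2) by (simp add: r_def)
    ultimately obtain \<phi> where "\<phi> \<in> test_functions" "deriv \<phi> = \<psi>'"
      using test_function_with_deriv by metis
    then have "integral \<Omega> (\<lambda>x. u x * \<psi>' x) = 0"
      using zero by auto
    then have "integral \<Omega> (\<lambda>x. u x * \<psi> x) = c * integral \<Omega> \<psi>"
      using lin[OF u] by (simp add: c_def r_def)
    moreover have "integral \<Omega> (\<lambda>x. v x * \<psi> x) = integral \<Omega> (\<lambda>x. u x * \<psi> x) - integral \<Omega> (\<lambda>x. c * \<psi> x)"
      unfolding v_def left_diff_distrib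
      by (intro Henstock_Kurzweil_Integration.integral_diff intg u \<psi>
          integrable_continuous_real continuous_intros flat_alg_continuous_on)
    ultimately show ?thesis by simp
  qed
  have "integral {a..b} v = 0" if ab: "0 \<le> a" "a < b" "b \<le> 1" for a b
  proof -
    obtain \<psi> :: "nat \<Rightarrow> real \<Rightarrow> real" where \<psi>: "\<And>n. \<psi> n \<in> flat_alg" "\<And>n x. \<bar>\<psi> n x\<bar> \<le> 1"
      "\<And>n. \<exists>d>0. \<forall>x. x \<notin> {d..1-d} \<longrightarrow> \<psi> n x = 0"
      "\<And>x. (\<lambda>n. \<psi> n x) \<longlonglongrightarrow> (if x \<in> {a<..<b} then 1 else 0)"
      using interval_indicator_approx[OF ab(1,3)] by metis
    have "integral \<Omega> (\<lambda>x. v x * \<psi> n x) = 0" for n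
      using \<psi>(3)[of n] v_orth[OF \<psi>(1)] by blast
    then show ?thesis
      using tendsto_integral_mult_indicator[OF v ab(1,3) \<psi>(1,2,4)]
      by (simp add: LIMSEQ_const_iff)
  qed
  then have "AE x in lebesgue_on \<Omega>. v x = 0"
    using v by (intro interval_integrals_zero_imp_AE_zero) (auto simp: absolutely_integrable_on_def)
  then have "AE x in lebesgue_on \<Omega>. u x = c"
    by (simp add: v_def)
  with that show thesis .
qed

section \<open>Integration by parts for a primitive\<close>

text \<open>
  The primitive of \<open>g\<close> need not be differentiable everywhere. Instead, the defect \<open>R\<close> of the formula
  on \<open>[a, x]\<close> has increments of order \<open>\<bar>y - x\<bar>\<close> times the integral of \<open>\<bar>g\<bar>\<close> over \<open>[x, y]\<close>, which is
  \<open>o(\<bar>y - x\<bar>)\<close>; so \<open>R\<close> has derivative 0 everywhere.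
\<close>

lemma integration_by_parts_primitive:
  fixes g \<phi> \<phi>' :: "real \<Rightarrow> real"
  assumes "a \<le> b" and g: "g absolutely_integrable_on {a..b}"
    and \<phi>: "\<And>x. x \<in> {a..b} \<Longrightarrow> (\<phi> has_real_derivative \<phi>' x) (at x within {a..b})"
    and \<phi>': "continuous_on {a..b} \<phi>'"
  shows "integral {a..b} (\<lambda>x. integral {a..x} g * \<phi>' x) + integral {a..b} (\<lambda>x. g x * \<phi> x)
         = integral {a..b} g * \<phi> b"
proof -
  define G where "G x = integral {a..x} g" for x
  define H where "H x = integral {a..x} (\<lambda>t. \<bar>g t\<bar>)" for x
  define F where "F x = G x * \<phi>' x + g x * \<phi> x" for x
  define R where "R x = G x * \<phi> x - integral {a..x} F" for x
  have gi: "g integrable_on {a..b}" "(\<lambda>t. \<bar>g t\<bar>) integrable_on {a..b}"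
    using g by (auto simp: absolutely_integrable_on_def)
  have G_cont: "continuous_on {a..b} G" and H_cont: "continuous_on {a..b} H"
    unfolding G_def H_def by (intro indefinite_integral_continuous_1 gi)+
  have \<phi>_cont: "continuous_on {a..b} \<phi>"
    using \<phi> DERIV_continuous_on by blast
  have i1: "(\<lambda>x. G x * \<phi>' x) integrable_on {a..b}"
    by (intro integrable_continuous_real continuous_intros G_cont \<phi>')
  have i2: "(\<lambda>x. g x * \<phi> x) integrable_on {a..b}"
    using absolutely_integrable_mult_continuous[OF g \<phi>_cont] by (simp add: absolutely_integrable_on_def)
  have Fi: "F integrable_on {a..b}"
    unfolding F_def by (intro integrable_add i1 i2)
  have sub: "f integrable_on {x..y}" if "f integrable_on {a..b}" "a \<le> x" "y \<le> b" for f :: "real \<Rightarrow> real" and x y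
    by (rule integrable_on_subinterval[OF that(1)]) (use that in auto)
  have split: "integral {a..y} f - integral {a..x} f = integral {x..y} f"
    if "f integrable_on {a..b}" "a \<le> x" "x \<le> y" "y \<le> b" for f :: "real \<Rightarrow> real" and x y
    using Henstock_Kurzweil_Integration.integral_combine[of a x y f] sub[OF that(1), of a y] that by simp
  obtain M where "M \<ge> 0" and M: "\<And>x. x \<in> {a..b} \<Longrightarrow> \<bar>\<phi>' x\<bar> \<le> M"
  proof -
    have "bounded (\<phi>' ` {a..b})"
      by (intro compact_imp_bounded compact_continuous_image \<phi>') simp
    then obtain B where "B > 0" "\<forall>y\<in>\<phi>' ` {a..b}. norm y \<le> B"
      unfolding bounded_pos by blast
    then show thesis by (intro that[of B]) auto
  qed
  \<comment> \<open>The factor 2 counts two errors: freezing \<phi> at x in the integral of g *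
    \<phi>, and freezing G at y in the integral of G * \<phi>'. Opposite endpoints are used so that
    the main terms G y * (\<phi> y - \<phi> x) and \<phi> x * (G y - G x) add up exactly to the
    increment of G * \<phi>.\<close>
  have R_increment: "\<bar>R y - R x\<bar> \<le> 2 * M * (y - x) * (H y - H x)" if xy: "a \<le> x" "x \<le> y" "y \<le> b" for x y
  proof -
    have sub': "f integrable_on {x..y}" if "f integrable_on {a..b}" for f :: "real \<Rightarrow> real"
      using sub[OF that] xy by simp
    have Hxy: "integral {x..y} (\<lambda>t. \<bar>g t\<bar>) = H y - H x"
      using split[OF gi(2) xy] by (simp add: H_def)
    have "\<bar>integral {x..y} (\<lambda>t. g t * \<phi> t - \<phi> x * g t)\<bar> \<le> integral {x..y} (\<lambda>t. (M * (y - x)) * \<bar>g t\<bar>)"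
    proof (rule Henstock_Kurzweil_Integration.integral_norm_bound_integral[where 'a = real, simplified real_norm_def])
      show "(\<lambda>t. g t * \<phi> t - \<phi> x * g t) integrable_on {x..y}"
        by (intro integrable_diff integrable_on_mult_right sub' i2 gi)
      show "(\<lambda>t. (M * (y - x)) * \<bar>g t\<bar>) integrable_on {x..y}"
        by (intro integrable_on_mult_right sub' gi)
      fix t assume t: "t \<in> {x..y}"
      have "norm (\<phi> t - \<phi> x) \<le> M * norm (t - x)"
        by (rule field_differentiable_bound[of "{a..b}" \<phi> \<phi>']) (use \<phi> M t xy in auto)
      also have "\<dots> \<le> M * (y - x)"
        using t \<open>M \<ge> 0\<close> by (intro mult_left_mono) auto
      finally have "\<bar>\<phi> t - \<phi> x\<bar> * \<bar>g t\<bar> \<le> M * (y - x) * \<bar>g t\<bar>"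
        by (intro mult_right_mono) auto
      then show "\<bar>g t * \<phi> t - \<phi> x * g t\<bar> \<le> M * (y - x) * \<bar>g t\<bar>"
        by (simp add: abs_mult[symmetric] algebra_simps)
    qed
    moreover have "integral {x..y} (\<lambda>t. g t * \<phi> t - \<phi> x * g t)
        = integral {x..y} (\<lambda>t. g t * \<phi> t) - \<phi> x * (G y - G x)"
      using split[OF gi(1) xy] Henstock_Kurzweil_Integration.integral_diff[OF sub'[OF i2]
          integrable_on_mult_right[OF sub'[OF gi(1)]], of "\<phi> x"] by (simp add: G_def)
    ultimately have 1: "\<bar>integral {x..y} (\<lambda>t. g t * \<phi> t) - \<phi> x * (G y - G x)\<bar> \<le> M * (y - x) * (H y - H x)"
      by (simp add: Hxy)
    have \<phi>'_int: "(\<phi>' has_integral (\<phi> y - \<phi> x)) {x..y}"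
      using xy by (intro fundamental_theorem_of_calculus)
        (auto simp: has_real_derivative_iff_has_vector_derivative[symmetric] intro: DERIV_subset[OF \<phi>])
    have "\<bar>integral {x..y} (\<lambda>t. G t * \<phi>' t - G y * \<phi>' t)\<bar> \<le> integral {x..y} (\<lambda>t. (H y - H x) * M)"
    proof (rule Henstock_Kurzweil_Integration.integral_norm_bound_integral[where 'a = real, simplified real_norm_def])
      show "(\<lambda>t. G t * \<phi>' t - G y * \<phi>' t) integrable_on {x..y}"
        using \<phi>'_int by (intro integrable_diff integrable_on_mult_right sub'[OF i1]) blast
      fix t assume t: "t \<in> {x..y}"
      have "\<bar>G y - G t\<bar> = \<bar>integral {t..y} g\<bar>"
        using split[OF gi(1), of t y] t xy by (simp add: G_def)
      also have "\<dots> \<le> integral {t..y} (\<lambda>t. \<bar>g t\<bar>)"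
        using t xy sub[OF gi(1), of t y] sub[OF gi(2), of t y]
          Henstock_Kurzweil_Integration.integral_norm_bound_integral[of g "{t..y}" "\<lambda>t. \<bar>g t\<bar>"] by simp
      also have "\<dots> \<le> integral {x..y} (\<lambda>t. \<bar>g t\<bar>)"
        using t xy sub[OF gi(2), of t y] sub'[OF gi(2)] by (intro integral_subset_le) auto
      finally have "\<bar>G t - G y\<bar> * \<bar>\<phi>' t\<bar> \<le> (H y - H x) * M"
        using M[of t] t xy by (intro mult_mono) (auto simp: Hxy)
      then show "\<bar>G t * \<phi>' t - G y * \<phi>' t\<bar> \<le> (H y - H x) * M"
        by (simp add: abs_mult[symmetric] algebra_simps)
    qed (rule integrable_const_ivl)
    moreover have "integral {x..y} (\<lambda>t. G t * \<phi>' t - G y * \<phi>' t)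
        = integral {x..y} (\<lambda>t. G t * \<phi>' t) - G y * (\<phi> y - \<phi> x)"
      using Henstock_Kurzweil_Integration.integral_diff[OF sub'[OF i1]
          integrable_on_mult_right[of \<phi>' "{x..y}" "G y"]] \<phi>'_int
      by (auto simp: integral_unique)
    ultimately have 2: "\<bar>integral {x..y} (\<lambda>t. G t * \<phi>' t) - G y * (\<phi> y - \<phi> x)\<bar> \<le> M * (y - x) * (H y - H x)"
      using xy by (simp add: mult_ac)
    have "R y - R x = G y * \<phi> y - G x * \<phi> x - integral {x..y} F"
      using split[OF Fi xy] by (simp add: R_def)
    also have "integral {x..y} F = integral {x..y} (\<lambda>t. G t * \<phi>' t) + integral {x..y} (\<lambda>t. g t * \<phi> t)"
      unfolding F_def by (intro Henstock_Kurzweil_Integration.integral_add sub' i1 i2)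
    finally have "R y - R x = - (integral {x..y} (\<lambda>t. G t * \<phi>' t) - G y * (\<phi> y - \<phi> x))
        - (integral {x..y} (\<lambda>t. g t * \<phi> t) - \<phi> x * (G y - G x))"
      by (simp add: algebra_simps)
    with 1 2 show ?thesis by linarith
  qed
  have "(R has_real_derivative 0) (at x within {a..b})" if x: "x \<in> {a..b}" for x
    unfolding has_field_derivative_iff
  proof (rule Lim_null_comparison)
    have "((\<lambda>y. 2 * M * \<bar>H y - H x\<bar>) \<longlongrightarrow> 2 * M * \<bar>H x - H x\<bar>) (at x within {a..b})"
      using H_cont x by (intro tendsto_intros) (auto simp: continuous_on_def)
    then show "((\<lambda>y. 2 * M * \<bar>H y - H x\<bar>) \<longlongrightarrow> 0) (at x within {a..b})"
      by simp
    have "norm ((R y - R x) / (y - x)) \<le> 2 * M * \<bar>H y - H x\<bar>" if y: "y \<in> {a..b}" "y \<noteq> x" for y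
    proof -
      have "\<bar>R y - R x\<bar> \<le> 2 * M * \<bar>y - x\<bar> * \<bar>H y - H x\<bar>"
      proof (cases "x \<le> y")
        case True
        then have "\<bar>R y - R x\<bar> \<le> 2 * M * (y - x) * (H y - H x)"
          using R_increment[of x y] x y by simp
        also have "\<dots> \<le> 2 * M * (y - x) * \<bar>H y - H x\<bar>"
          using True \<open>M \<ge> 0\<close> by (intro mult_left_mono) auto
        finally show ?thesis using True by simp
      next
        case False
        then have "\<bar>R x - R y\<bar> \<le> 2 * M * (x - y) * (H x - H y)"
          using R_increment[of y x] x y by simp
        also have "\<dots> \<le> 2 * M * (x - y) * \<bar>H x - H y\<bar>"
          using False \<open>M \<ge> 0\<close> by (intro mult_left_mono) auto
        finally show ?thesis using False by (simp add: abs_minus_commute)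
      qed
      then show ?thesis
        using y(2) by (simp add: abs_divide divide_le_eq mult_ac)
    qed
    then show "\<forall>\<^sub>F y in at x within {a..b}. norm ((R y - R x) / (y - x)) \<le> 2 * M * \<bar>H y - H x\<bar>"
      by (auto simp: eventually_at_filter)
  qed
  then obtain k where "\<And>x. x \<in> {a..b} \<Longrightarrow> R x = k"
    using has_field_derivative_zero_constant[of "{a..b}" R] by auto
  then have "R b = R a"
    using \<open>a \<le> b\<close> by simp
  moreover have "integral {a..b} F = integral {a..b} (\<lambda>x. G x * \<phi>' x) + integral {a..b} (\<lambda>x. g x * \<phi> x)"
    unfolding F_def by (intro Henstock_Kurzweil_Integration.integral_add i1 i2)
  ultimately show ?thesis
    by (simp add: R_def G_def)
qed

section \<open>Square-integrable functions and traces\<close>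

text \<open>Constants are integrable on the unit interval, so \<bar>t\<bar> \<le> 1 + t^2 provides
  the dominating function.\<close>

lemma L2_absolutely_integrable:
  assumes "f \<in> L2"
  shows "f absolutely_integrable_on \<Omega>"
proof (rule measurable_bounded_by_integrable_imp_absolutely_integrable)
  show "f \<in> borel_measurable (lebesgue_on \<Omega>)"
    using assms by (simp add: L2_def)
  have "(\<lambda>x. (f x)\<^sup>2) integrable_on \<Omega>"
    using assms by (intro integrable_on_lebesgue_on) (auto simp: L2_def)
  then show "(\<lambda>x. 1 + (f x)\<^sup>2) integrable_on \<Omega>"
    by (intro integrable_add integrable_const_ivl)
  show "norm (f x) \<le> 1 + (f x)\<^sup>2" for x
    using sum_squares_bound[of 1 "\<bar>f x\<bar>"] by simp
qed simp

lemma continuous_on_imp_L2: "continuous_on \<Omega> f \<Longrightarrow> f \<in> L2"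
  unfolding L2_def
  by (auto intro!: continuous_imp_measurable_on_sets_lebesgue continuous_imp_integrable_real
      continuous_on_power)

text \<open>The difference r of the two functions vanishes a.e., so the norm bound of the trace
  operator forces its trace to be 0; additivity does the rest.\<close>

lemma trace_cong_AE:
  assumes T: "trace_operator T" and u: "u \<in> W12" and v: "v \<in> W12"
    and ae: "AE x in lebesgue_on \<Omega>. u x = v x" and x: "x \<in> \<partial>\<Omega>"
  shows "T u x = T v x"
proof -
  define r where "r x = u x - v x" for x
  have r0: "AE x in lebesgue_on \<Omega>. r x = 0"
    using ae by (simp add: r_def)
  have int0: "(LINT x|lebesgue_on \<Omega>. r x * w x) = 0" for w
  proof -
    have "AE x in lebesgue_on \<Omega>. r x * w x = 0"
      using r0 by eventually_elim simp
    then show ?thesis by (rule integral_eq_zero_AE)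
  qed
  have "r \<in> borel_measurable (lebesgue_on \<Omega>)"
    using u v unfolding r_def W12_def L2_def by auto
  moreover have "integrable (lebesgue_on \<Omega>) (\<lambda>x. (r x)\<^sup>2)"
  proof -
    have "AE x in lebesgue_on \<Omega>. (0::real) = (r x)\<^sup>2"
      using r0 by eventually_elim simp
    moreover have "(\<lambda>x. (r x)\<^sup>2) \<in> borel_measurable (lebesgue_on \<Omega>)"
      using \<open>r \<in> _\<close> by simp
    ultimately show ?thesis
      using integrable_cong_AE_imp[OF integrable_zero] by blast
  qed
  ultimately have r_L2: "r \<in> L2" by (simp add: L2_def)
  have zero_L2: "(\<lambda>x. 0) \<in> L2" by (rule continuous_on_imp_L2) simp
  \<comment> \<open>Taking 0 as the weak derivative makes the right side of the norm bound 0 for any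
    constant C.\<close>
  have wd: "has_weak_deriv r (\<lambda>x. 0)"
    by (simp add: has_weak_deriv_def int0)
  have r_W12: "r \<in> W12"
    using r_L2 zero_L2 wd by (auto simp: W12_def)
  obtain C where "sqrt (\<Sum>x\<in>\<partial>\<Omega>. (T r x)\<^sup>2) \<le> C * sqrt ((L2_norm r)\<^sup>2 + (L2_norm (\<lambda>x. 0))\<^sup>2)"
    using T r_L2 zero_L2 wd unfolding trace_operator_def by blast
  then have "(\<Sum>x\<in>\<partial>\<Omega>. (T r x)\<^sup>2) \<le> 0"
    by (simp add: L2_norm_def L2_inner_def int0)
  then have "(T r 0)\<^sup>2 + (T r 1)\<^sup>2 \<le> 0"
    by simp
  then have "T r x = 0"
    using x by (auto simp: sum_power2_le_zero_iff)
  moreover have "T (\<lambda>y. v y + r y) x = T v x + T r x"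
    using T v r_W12 x unfolding trace_operator_def by blast
  moreover have "(\<lambda>y. v y + r y) = u"
    by (auto simp: r_def)
  ultimately show ?thesis by simp
qed

section \<open>Zero trace forces a derivative of mean zero\<close>

lemma integral_zero_of_D_image:
  assumes "g \<in> D_image W12_0"
  shows "integral \<Omega> g = 0"
proof -
  obtain h where gL2: "g \<in> L2" and h: "h \<in> W12_0" and wd: "has_weak_deriv h g"
    using assms by (auto simp: D_image_def)
  then obtain T where T: "trace_operator T" "\<And>x. x \<in> \<partial>\<Omega> \<Longrightarrow> T h x = 0" and hW: "h \<in> W12"
    by (auto simp: W12_0_def)
  have g: "g absolutely_integrable_on \<Omega>" and hi: "h absolutely_integrable_on \<Omega>"
    using gL2 hW by (auto intro: L2_absolutely_integrable simp: W12_def)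
  define G where "G x = integral {0..x} g" for x
  have G_cont: "continuous_on \<Omega> G"
    unfolding G_def by (intro indefinite_integral_continuous_1 absolutely_integrable_on_def[THEN iffD1, THEN conjunct1] g)
  \<comment> \<open>The boundary term vanishes because \<phi> 1 = 0, so g is a weak derivative of
    G.\<close>
  have by_parts: "integral \<Omega> (\<lambda>x. G x * deriv \<phi> x) = - integral \<Omega> (\<lambda>x. g x * \<phi> x)"
    if "\<phi> \<in> test_functions" for \<phi>
    using integration_by_parts_primitive[of 0 1 g \<phi> "deriv \<phi>"] g test_function_has_deriv[OF that]
      test_function_boundary[OF that] by (simp add: G_def has_field_derivative_at_within)
  \<comment> \<open>Constants thus have weak derivative 0, which lets c be added to G without
    changing its weak derivative.\<close>
  have deriv_int: "integral \<Omega> (deriv \<phi>) = 0" if "\<phi> \<in> test_functions" for \<phi>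
  proof -
    have "(deriv \<phi> has_integral (\<phi> 1 - \<phi> 0)) \<Omega>"
      using test_function_has_deriv(1)[OF that]
      by (intro fundamental_theorem_of_calculus)
        (auto simp: has_real_derivative_iff_has_vector_derivative[symmetric] has_field_derivative_at_within)
    then show ?thesis
      using test_function_boundary[OF that] by (simp add: integral_unique)
  qed
  have Gi: "G absolutely_integrable_on \<Omega>"
    by (rule absolutely_integrable_continuous_real) fact
  have "integral \<Omega> (\<lambda>x. (h x - G x) * deriv \<phi> x) = 0" if "\<phi> \<in> test_functions" for \<phi>
  proof -
    have "(\<lambda>x. h x * deriv \<phi> x) integrable_on \<Omega>" "(\<lambda>x. G x * deriv \<phi> x) integrable_on \<Omega>"
      using absolutely_integrable_mult_continuous[OF _ test_function_has_deriv(3)[OF that]] hi Gi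
      by (simp_all add: absolutely_integrable_on_def)
    then have "integral \<Omega> (\<lambda>x. (h x - G x) * deriv \<phi> x)
        = integral \<Omega> (\<lambda>x. h x * deriv \<phi> x) - integral \<Omega> (\<lambda>x. G x * deriv \<phi> x)"
      by (simp add: left_diff_distrib Henstock_Kurzweil_Integration.integral_diff)
    then show ?thesis
      using wd by_parts that by (simp add: weak_deriv_integral[OF hi g])
  qed
  then obtain c where c: "AE x in lebesgue_on \<Omega>. h x - G x = c"
    using du_Bois_Reymond[OF set_integral_diff(1)[OF hi Gi]] by blast
  define V where "V x = G x + c" for x
  have V_cont: "continuous_on \<Omega> V"
    unfolding V_def by (intro continuous_intros G_cont)
  then have V: "V \<in> L2" "V absolutely_integrable_on \<Omega>"
    by (auto intro: continuous_on_imp_L2 absolutely_integrable_continuous_real)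
  have "integral \<Omega> (\<lambda>x. V x * deriv \<phi> x) = - integral \<Omega> (\<lambda>x. g x * \<phi> x)"
    if "\<phi> \<in> test_functions" for \<phi>
  proof -
    have "integral \<Omega> (\<lambda>x. V x * deriv \<phi> x)
        = integral \<Omega> (\<lambda>x. G x * deriv \<phi> x) + integral \<Omega> (\<lambda>x. c * deriv \<phi> x)"
      unfolding V_def distrib_right
      by (intro Henstock_Kurzweil_Integration.integral_add integrable_continuous_real
          continuous_intros G_cont test_function_has_deriv(3) that)
    then show ?thesis
      using by_parts[OF that] deriv_int[OF that] by simp
  qed
  then have "V \<in> W12"
    using V gL2 weak_deriv_integral[OF V(2) g] by (auto simp: W12_def)
  moreover have "AE x in lebesgue_on \<Omega>. h x = V x"
    using c by eventually_elim (simp add: V_def)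
  ultimately have "T V x = 0" if "x \<in> \<partial>\<Omega>" for x
    using trace_cong_AE[OF T(1) hW, of V x] T(2) that by simp
  \<comment> \<open>Continuity of V pays off here: its traces are its boundary values.\<close>
  moreover have "T V x = V x" if "x \<in> \<partial>\<Omega>" for x
    using T(1) \<open>V \<in> W12\<close> V_cont that unfolding trace_operator_def by blast
  ultimately have "V 0 = 0" "V 1 = 0"
    by (metis insertI1, metis insertI1 insertI2)
  \<comment> \<open>\<open>V 0\<close> is c, since the integral over \<open>{0..0}\<close> is 0; so
    c = 0 and \<open>V 1\<close> is the integral of g.\<close>
  then show ?thesis by (simp add: V_def G_def)
qed

section \<open>Orthogonality of the two spaces\<close>

lemma AE_constant_of_A2:
  assumes "f \<in> A2"
  obtains c where "AE x in lebesgue_on \<Omega>. f x = c"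
proof (rule du_Bois_Reymond)
  show f: "f absolutely_integrable_on \<Omega>"
    using assms by (auto simp: A2_def intro: L2_absolutely_integrable)
  have zero: "(\<lambda>x. 0 :: real) absolutely_integrable_on \<Omega>"
    by simp
  show "integral \<Omega> (\<lambda>x. f x * deriv \<phi> x) = 0" if "\<phi> \<in> test_functions" for \<phi>
    using assms that by (simp add: A2_def weak_deriv_integral[OF f zero])
qed (use that in blast)

theorem mainTheorem11:
  fixes f g :: "real \<Rightarrow> real"
  assumes "f \<in> A2" and "\<not> L2_zero f"
    and "g \<in> D_image W12_0" and "\<not> L2_zero g"
  shows "L2_angle f g = pi / 2"
proof -
  obtain c where c: "AE x in lebesgue_on \<Omega>. f x = c"
    using AE_constant_of_A2[OF assms(1)] .
  have meas: "f \<in> borel_measurable (lebesgue_on \<Omega>)" "g \<in> borel_measurable (lebesgue_on \<Omega>)"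
    using assms(1,3) by (auto simp: A2_def D_image_def L2_def)
  have "L2_inner f g = (LINT x|lebesgue_on \<Omega>. c * g x)"
    unfolding L2_inner_def
  proof (rule integral_cong_AE)
    show "AE x in lebesgue_on \<Omega>. f x * g x = c * g x"
      using c by eventually_elim simp
  qed (use meas in simp_all)
  also have "\<dots> = c * (LINT x|lebesgue_on \<Omega>. g x)"
    by simp
  also have "(LINT x|lebesgue_on \<Omega>. g x) = integral \<Omega> g"
    using assms(3) by (auto intro!: lebesgue_integral_eq_integral absolutely_integrable_imp_integrable
        L2_absolutely_integrable simp: D_image_def)
  also have "\<dots> = 0"
    by (rule integral_zero_of_D_image) fact
  finally show ?thesis
    by (simp add: L2_angle_def)
qed

end
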